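(* Let $d\ge 0$ and $k\ge 1$ be integers, let $G=(V,E)$ be a $d$-manifold (a finite simple graph, in the discrete sense), and let $f=(f_1,\dots,f_k):V\to\mathbb{R}^k$ be any function. Let $W\subset\{-1,1\}^k$ be a fixed set of $k$ distinct sign vectors, used to define level surfaces. Then for every $c=(c_1,\dots,c_k)\in\mathbb{R}^k$ with $c\notin f(V)$, the level surface $\{f=c\}$ is a $(d-k)$-manifold or empty.
   Context: All graphs are finite simple graphs. For a vertex $v$ of a graph $G=(V,E)$, the unit sphere $S(v)$ is the sub-graph of $G$ induced by the set of vertices adjacent to $v$, and $G-v$ is the graph obtained by deleting $v$ and all edges at $v$. The following notions are defined by induction. - Contractible: the one-vertex graph is contractible; a graph $G$ is contractible if for some vertex $v$ both $S(v)$ and $G-v$ are contractible. - $d$-manifold: $G$ is a $d$-manifold if every unit sphere $S(v)$, $v\in V$, is a $(d-1)$-sphere. - $d$-sphere: the empty graph is the $(-1)$-sphere; for $d\ge 0$, a $d$-sphere is a $d$-manifold $G$ such that $G-v$ is contractible for some vertex $v$. A simplex of $G$ is a non-empty set of pairwise adjacent vertices (the vertex set of a complete sub-graph). The Barycentric refinement $G_1$ of $G$ is the graph whose vertices are the simplices of $G$, two distinct simplices being adjacent if one is contained in the other. For real $t$, $\mathrm{sign}(t)\in\{-1,0,1\}$ is the usual sign; on $\mathbb{R}^k$ it is applied coordinatewise. Level surface: a set $W\subset\{-1,1\}^k$ of $k$ sign vectors is fixed, for example $W=\{(-1,1,\dots,1),(1,-1,\dots,1),\dots,(1,1,\dots,-1)\}$.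 For $f:V\to\mathbb{R}^k$ and $c\in\mathbb{R}^k$, $\{f=c\}=\{f_1=c_1,\dots,f_k=c_k\}$ is the sub-graph of $G_1$ induced by those simplices $x$ of $G$ for which the set $\{\mathrm{sign}(f(v)-c): v\in x\}$ has at least $k+1$ elements and contains $W$. *)

theory Defs
  imports "HOL-Analysis.Finite_Cartesian_Product" "Graph_Theory.Digraph_Component"
begin

text \<open>
  Finite simple graphs are instances of the locale \<^locale>\<open>graph\<close>: finite, loop-free,
  symmetric digraphs without parallel arcs, an undirected edge being a pair of opposite arcs.
\<close>

definition unit_sphere :: "('a, 'b) pre_digraph \<Rightarrow> 'a \<Rightarrow> ('a, 'b) pre_digraph" where
  "unit_sphere G v = G \<restriction> {w \<in> verts G. v \<rightarrow>\<^bsub>G\<^esub> w}"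

inductive contractible :: "('a, 'b) pre_digraph \<Rightarrow> bool" where
  one_vertex: "verts G = {v} \<Longrightarrow> contractible G"
| extend: "v \<in> verts G \<Longrightarrow> contractible (unit_sphere G v) \<Longrightarrow>
    contractible (pre_digraph.del_vert G v) \<Longrightarrow> contractible G"

text \<open>
  The dimension is an integer. There are no spheres of dimension below \<open>-1\<close>, so for \<open>d < 0\<close>
  the empty graph is the only \<open>d\<close>-manifold; it is a \<open>d\<close>-manifold for every \<open>d\<close>.
\<close>

inductive is_manifold :: "int \<Rightarrow> ('a, 'b) pre_digraph \<Rightarrow> bool"
  and is_sphere :: "int \<Rightarrow> ('a, 'b) pre_digraph \<Rightarrow> bool" where
  manifold: "(\<forall>v \<in> verts G. is_sphere (d - 1) (unit_sphere G v)) \<Longrightarrow> is_manifold d G"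
| empty_sphere: "verts G = {} \<Longrightarrow> is_sphere (- 1) G"
| sphere: "0 \<le> d \<Longrightarrow> is_manifold d G \<Longrightarrow> v \<in> verts G \<Longrightarrow>
    contractible (pre_digraph.del_vert G v) \<Longrightarrow> is_sphere d G"

definition simplices :: "('a, 'b) pre_digraph \<Rightarrow> 'a set set" where
  "simplices G = {x. x \<noteq> {} \<and> x \<subseteq> verts G \<and> (\<forall>u \<in> x. \<forall>v \<in> x. u \<noteq> v \<longrightarrow> u \<rightarrow>\<^bsub>G\<^esub> v)}"

definition barycentric_refinement ::
    "('a, 'b) pre_digraph \<Rightarrow> ('a set, 'a set \<times> 'a set) pre_digraph" where
  "barycentric_refinement G = with_proj
     \<lparr> pverts = simplices G,
       parcs = {(x, y). x \<in> simplices G \<and> y \<in> simplices G \<and> (x \<subset> y \<or> y \<subset> x)} \<rparr>"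

definition sign_vec :: "real ^ 'k \<Rightarrow> real ^ 'k" where
  "sign_vec t = (\<chi> i. sgn (t $ i))"

definition level_surface ::
    "(real ^ 'k) set \<Rightarrow> ('a, 'b) pre_digraph \<Rightarrow> ('a \<Rightarrow> real ^ 'k) \<Rightarrow> real ^ 'k \<Rightarrow>
     ('a set, 'a set \<times> 'a set) pre_digraph" where
  "level_surface W G f c = barycentric_refinement G \<restriction>
     {x \<in> simplices G. CARD('k) + 1 \<le> card ((\<lambda>v. sign_vec (f v - c)) ` x) \<and>
                       W \<subseteq> (\<lambda>v. sign_vec (f v - c)) ` x}"

lemma finite_simplices:
  assumes "finite (verts G)"
  shows "finite (simplices G)"
  by (rule finite_subset[of _ "Pow (verts G)"]) (use assms in \<open>auto simp: simplices_def\<close>)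

lemma graph_level_surface:
  fixes G :: "('a, 'b) pre_digraph"
  assumes "graph G"
  shows "graph (level_surface W G f c)"
proof -
  interpret G: graph G by fact
  have fin: "finite (simplices G)"
    by (intro finite_simplices G.finite_verts)
  have fin2: "finite {(x, y). x \<in> simplices G \<and> y \<in> simplices G \<and> (x \<subset> y \<or> y \<subset> x)}"
    by (rule finite_subset[of _ "simplices G \<times> simplices G"]) (use fin in auto)
  show ?thesis
    by unfold_locales
      (use fin fin2 in \<open>auto simp: level_surface_def barycentric_refinement_def arc_to_ends_def
        symmetric_def arcs_ends_def sym_def image_iff\<close>)
qed

end

theory Submission
  imports Defs
begin

text \<open>
  Only which vectors of \<open>W\<close> a simplex attains matters: give a vertex \<open>v\<close> the sign vector of
  \<open>f v - c\<close> as its colour if that vector lies in \<open>W\<close>, and one further common colour otherwise.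
  Since \<open>W\<close> has \<open>k\<close> elements, a simplex \<open>x\<close> attains all of \<open>W\<close> and at least \<open>k + 1\<close> sign
  vectors exactly when it attains all \<open>k + 1\<close> colours. This condition passes to larger simplices.

  Let \<open>x\<close> be a vertex of the level surface. Each proper subset of \<open>x\<close> is comparable with each
  proper superset, so the unit sphere of \<open>x\<close> is the join of two parts.

  \<^item> The supersets of \<open>x\<close> correspond to the simplices of the common neighbourhood of the vertices of
    \<open>x\<close>. By iterating unit spheres, this neighbourhood is a sphere of dimension \<open>d - |x|\<close>, and
    barycentric refinement preserves spheres (\<open>sphere_on_cofaces\<close>).

  \<^item> The proper subsets of \<open>x\<close> that still attain all colours choose a non-empty subset of each
    colour class. They are the proper faces of a product of \<open>k + 1\<close> simplices and form a sphere of
    dimension \<open>|x| - k - 2\<close> (\<open>sphere_on_faces_onto\<close>).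

  A join of spheres is a sphere (\<open>sphere_on_join\<close>), and dimensions add up with one more, which
  gives \<open>d - k - 1\<close>, as required.

  Spheres involve contractibility, and all the contractions needed come from one principle
  (\<open>contractible_on_add_cones\<close>): a contractible graph stays contractible when vertices are added
  one by one, each of them having, at the moment of its addition, a cone as its unit sphere. In a
  family of sets ordered by inclusion the apex of the cone arises by removing or inserting a
  well-chosen element.
\<close>

section \<open>Contractible graphs and spheres as vertex sets\<close>

text \<open>
  All graphs that occur in an inductive argument are induced sub-graphs of one ambient graph. It is
  therefore enough to fix an adjacency relation and to speak about vertex sets; no isomorphisms
  or restricted arc sets have to be tracked.
\<close>

definition nbrs :: "('a \<Rightarrow> 'a \<Rightarrow> bool) \<Rightarrow> 'a \<Rightarrow> 'a set \<Rightarrow> 'a set" where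
  "nbrs E v V = {w \<in> V. E v w}"

inductive contractible_on :: "('a \<Rightarrow> 'a \<Rightarrow> bool) \<Rightarrow> 'a set \<Rightarrow> bool" for E where
  single: "contractible_on E {v}"
| extend: "v \<in> V \<Longrightarrow> contractible_on E (nbrs E v V) \<Longrightarrow> contractible_on E (V - {v}) \<Longrightarrow> contractible_on E V"

text \<open>
  The index is the dimension plus one, so that the empty sphere has index 0 and the index of a join
  is the sum of the indices.
\<close>

primrec sphere_on :: "('a \<Rightarrow> 'a \<Rightarrow> bool) \<Rightarrow> nat \<Rightarrow> 'a set \<Rightarrow> bool" where
  "sphere_on E 0 V \<longleftrightarrow> V = {}"
| "sphere_on E (Suc n) V \<longleftrightarrow>
     (\<forall>v \<in> V. sphere_on E n (nbrs E v V)) \<and> (\<exists>v \<in> V. contractible_on E (V - {v}))"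

lemma contractible_on_finite: "contractible_on E V \<Longrightarrow> finite V"
  by (induction rule: contractible_on.induct) auto

lemma sphere_on_finite: "sphere_on E n V \<Longrightarrow> finite V"
  by (cases n) (auto dest: contractible_on_finite)

section \<open>Translation between digraphs and vertex sets\<close>

lemma dominates_induce_subgraph:
  "u \<rightarrow>\<^bsub>H \<restriction> S\<^esub> v \<longleftrightarrow> u \<in> S \<and> v \<in> S \<and> u \<rightarrow>\<^bsub>H\<^esub> v"
  by (auto simp: arcs_ends_def arc_to_ends_def)

lemma dominates_del_vert:
  "u \<rightarrow>\<^bsub>pre_digraph.del_vert H w\<^esub> v \<longleftrightarrow> u \<noteq> w \<and> v \<noteq> w \<and> u \<rightarrow>\<^bsub>H\<^esub> v"
  by (auto simp: arcs_ends_def arc_to_ends_def pre_digraph.del_vert_simps)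

definition has_adjacency :: "('a, 'b) pre_digraph \<Rightarrow> ('a \<Rightarrow> 'a \<Rightarrow> bool) \<Rightarrow> bool" where
  "has_adjacency H E \<longleftrightarrow> (\<forall>u \<in> verts H. \<forall>v \<in> verts H. u \<rightarrow>\<^bsub>H\<^esub> v \<longleftrightarrow> E u v)"

lemma verts_unit_sphere:
  "has_adjacency H E \<Longrightarrow> v \<in> verts H \<Longrightarrow> verts (unit_sphere H v) = nbrs E v (verts H)"
  by (auto simp: has_adjacency_def unit_sphere_def nbrs_def)

lemma has_adjacency_unit_sphere:
  "has_adjacency H E \<Longrightarrow> has_adjacency (unit_sphere H v) E"
  by (auto simp: has_adjacency_def unit_sphere_def dominates_induce_subgraph)

lemma has_adjacency_del_vert:
  "has_adjacency H E \<Longrightarrow> has_adjacency (pre_digraph.del_vert H v) E"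
  by (auto simp: has_adjacency_def dominates_del_vert pre_digraph.verts_del_vert)

lemma contractible_iff_contractible_on:
  assumes "has_adjacency H E"
  shows "contractible H \<longleftrightarrow> contractible_on E (verts H)"
proof
  show "contractible_on E (verts H)" if "contractible H"
    using that assms
  proof (induction rule: contractible.induct)
    case (one_vertex H v)
    then show ?case by (simp add: contractible_on.single)
  next
    case (extend v H)
    then show ?case
      using contractible_on.extend[of v "verts H" E] verts_unit_sphere[of H E v]
      by (simp add: has_adjacency_unit_sphere has_adjacency_del_vert pre_digraph.verts_del_vert)
  qed
  show "contractible H" if "contractible_on E (verts H)"
    using that assms
  proof (induction "verts H" arbitrary: H rule: contractible_on.induct)
    case (single v)
    then show ?case by (metis contractible.one_vertex)
  next
    case (extend v)
    show ?case
      by (rule contractible.extend[OF extend.hyps(1)])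
        (use extend verts_unit_sphere[of H E v] in
          \<open>simp_all add: has_adjacency_unit_sphere has_adjacency_del_vert pre_digraph.verts_del_vert\<close>)
  qed
qed

lemma is_sphere_iff_sphere_on:
  assumes "has_adjacency H E"
  shows "is_sphere (int n - 1) H \<longleftrightarrow> sphere_on E n (verts H)"
  using assms
proof (induction n arbitrary: H)
  case 0
  show ?case by (subst is_sphere.simps) auto
next
  case (Suc n)
  have "is_sphere (int (Suc n) - 1) H \<longleftrightarrow>
      (\<forall>v \<in> verts H. is_sphere (int n - 1) (unit_sphere H v)) \<and>
      (\<exists>v \<in> verts H. contractible (pre_digraph.del_vert H v))"
    by (subst is_sphere.simps) (auto simp: is_manifold.simps)
  then show ?case
    using Suc contractible_iff_contractible_on[OF has_adjacency_del_vert[OF Suc.prems]]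
    by (simp add: verts_unit_sphere has_adjacency_unit_sphere pre_digraph.verts_del_vert)
qed

section \<open>Cones, joins and links\<close>

locale adjacency =
  fixes E :: "'a \<Rightarrow> 'a \<Rightarrow> bool"
  assumes sym: "E u v \<Longrightarrow> E v u" and irrefl: "\<not> E v v"
begin

text \<open>
  Any vertex \<open>b\<close> of the base can be removed first: its unit sphere and what remains are cones with
  the same apex over smaller bases.
\<close>

lemma contractible_on_cone:
  assumes "finite B" "\<forall>b \<in> B. E v b"
  shows "contractible_on E (insert v B)"
  using assms
proof (induction B rule: finite_psubset_induct)
  case (psubset B)
  show ?case
  proof (cases "B = {}")
    case True
    then show ?thesis by (simp add: contractible_on.single)
  next
    case False
    then obtain b where b: "b \<in> B" by blast
    then have "b \<noteq> v" using psubset.prems irrefl by blast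
    have "nbrs E b B \<subset> B" using b irrefl by (auto simp: nbrs_def)
    moreover have "nbrs E b (insert v B) = insert v (nbrs E b B)"
      using b psubset.prems sym by (auto simp: nbrs_def)
    ultimately have 1: "contractible_on E (nbrs E b (insert v B))"
      using psubset by auto
    have "contractible_on E (insert v (B - {b}))" using psubset b by auto
    then have 2: "contractible_on E (insert v B - {b})"
      using \<open>b \<noteq> v\<close> by (simp add: insert_Diff_if)
    show ?thesis by (rule contractible_on.extend[OF _ 1 2]) (use b in simp)
  qed
qed

text \<open>
  A contraction of one factor is a contraction of the join, because taking unit spheres and deleting
  vertices of \<open>A\<close> both commute with joining \<open>B\<close>; it ends in a cone over \<open>B\<close>.
\<close>

lemma contractible_on_join:
  assumes "contractible_on E A" "finite B" "\<forall>a \<in> A. \<forall>b \<in> B. E a b"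
  shows "contractible_on E (A \<union> B)"
  using assms
proof (induction rule: contractible_on.induct)
  case (single v)
  then show ?case using contractible_on_cone by simp
next
  case (extend v A)
  have "v \<notin> B" using extend irrefl by blast
  then have "A \<union> B - {v} = (A - {v}) \<union> B" by blast
  moreover have "nbrs E v (A \<union> B) = nbrs E v A \<union> B"
    using extend by (auto simp: nbrs_def)
  moreover have "contractible_on E (nbrs E v A \<union> B)"
    by (rule extend.IH(1)) (use extend.prems in \<open>auto simp: nbrs_def\<close>)
  moreover have "contractible_on E ((A - {v}) \<union> B)"
    by (rule extend.IH(2)) (use extend.prems in auto)
  ultimately show ?case using extend by - (rule contractible_on.extend[of v], auto)
qed

text \<open>
  The vertices of \<open>R\<close> are added to \<open>A\<close> in the order of decreasing \<open>h\<close>. When \<open>y\<close> is added, the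
  vertices of \<open>R\<close> present are among those with \<open>h y \<le> h b\<close>, and the vertex \<open>m\<close> of \<open>A\<close> makes the
  unit sphere of \<open>y\<close> a cone with apex \<open>m\<close>. In families of sets, \<open>h = card\<close> means that, of the
  sets of \<open>R\<close> comparable with \<open>y\<close>, just the larger ones are present, and the cardinality of the
  complement means that just the smaller ones are.
\<close>

lemma contractible_on_add_cones:
  fixes h :: "'a \<Rightarrow> nat"
  assumes "finite R" "contractible_on E A" "A \<inter> R = {}"
    and "\<forall>y \<in> R. \<exists>m \<in> A. E y m \<and>
      (\<forall>b \<in> A \<union> R. E y b \<and> b \<noteq> m \<and> (b \<in> R \<longrightarrow> h y \<le> h b) \<longrightarrow> E m b)"
  shows "contractible_on E (A \<union> R)"
  using assms
proof (induction R rule: finite_psubset_induct)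
  case (psubset R)
  show ?case
  proof (cases "R = {}")
    case True
    then show ?thesis using psubset by simp
  next
    case False
    then obtain y where y: "y \<in> R" "\<forall>b \<in> R. h y \<le> h b"
      using psubset.hyps ex_min_if_finite[of "h ` R"] by (metis arg_min_least arg_min_if_finite(1))
    obtain m where m: "m \<in> A" "E y m"
      "\<forall>b \<in> A \<union> R. E y b \<and> b \<noteq> m \<and> (b \<in> R \<longrightarrow> h y \<le> h b) \<longrightarrow> E m b"
      using psubset.prems(3) y(1) by blast
    have "contractible_on E (A \<union> (R - {y}))"
    proof (rule psubset.IH)
      show "\<forall>y' \<in> R - {y}. \<exists>m \<in> A. E y' m \<and>
        (\<forall>b \<in> A \<union> (R - {y}). E y' b \<and> b \<noteq> m \<and> (b \<in> R - {y} \<longrightarrow> h y' \<le> h b) \<longrightarrow> E m b)"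
      proof
        fix y' assume y': "y' \<in> R - {y}"
        then obtain m' where m': "m' \<in> A" "E y' m'"
          "\<forall>b \<in> A \<union> R. E y' b \<and> b \<noteq> m' \<and> (b \<in> R \<longrightarrow> h y' \<le> h b) \<longrightarrow> E m' b"
          using psubset.prems(3) by blast
        show "\<exists>m \<in> A. E y' m \<and>
          (\<forall>b \<in> A \<union> (R - {y}). E y' b \<and> b \<noteq> m \<and> (b \<in> R - {y} \<longrightarrow> h y' \<le> h b) \<longrightarrow> E m b)"
          using m' psubset.prems(2) y(1) by (intro bexI[of _ m']) auto
      qed
    qed (use psubset.prems y in auto)
    moreover have "A \<union> R - {y} = A \<union> (R - {y})" using psubset.prems(2) y(1) by blast
    moreover have "contractible_on E (insert m (nbrs E y (A \<union> R) - {m}))"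
      by (rule contractible_on_cone)
        (use m y psubset contractible_on_finite[OF psubset.prems(1)] in \<open>auto simp: nbrs_def\<close>)
    moreover have "insert m (nbrs E y (A \<union> R) - {m}) = nbrs E y (A \<union> R)"
      using m by (auto simp: nbrs_def)
    ultimately show ?thesis using y(1) by - (rule contractible_on.extend[of y], auto)
  qed
qed

lemma sphere_on_join:
  assumes "sphere_on E m A" "sphere_on E n B" "\<forall>a \<in> A. \<forall>b \<in> B. E a b"
  shows "sphere_on E (m + n) (A \<union> B)"
  using assms
proof (induction "m + n" arbitrary: m n A B rule: less_induct)
  case less
  have swap: "\<forall>b \<in> B. \<forall>a \<in> A. E b a" using less.prems(3) sym by blast
  have dis: "A \<inter> B = {}" using less.prems(3) irrefl by blast
  note fin = sphere_on_finite[OF less.prems(1)] sphere_on_finite[OF less.prems(2)]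
  show ?case
  proof (cases "m + n")
    case 0
    then show ?thesis using less.prems by simp
  next
    case (Suc p)
    have nA: "sphere_on E p (nbrs E v (A \<union> B))" if v: "v \<in> A" for v
    proof -
      obtain m' where m': "m = Suc m'" using less.prems(1) v by (cases m) auto
      have "sphere_on E (m' + n) (nbrs E v A \<union> B)"
        by (rule less.hyps) (use less.prems v m' in \<open>auto simp: nbrs_def\<close>)
      moreover have "nbrs E v (A \<union> B) = nbrs E v A \<union> B"
        using v less.prems(3) by (auto simp: nbrs_def)
      ultimately show ?thesis using m' Suc by simp
    qed
    have nB: "sphere_on E p (nbrs E v (A \<union> B))" if v: "v \<in> B" for v
    proof -
      obtain n' where n': "n = Suc n'" using less.prems(2) v by (cases n) auto
      have "sphere_on E (m + n') (A \<union> nbrs E v B)"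
        by (rule less.hyps) (use less.prems v n' in \<open>auto simp: nbrs_def\<close>)
      moreover have "nbrs E v (A \<union> B) = A \<union> nbrs E v B"
        using v swap by (auto simp: nbrs_def)
      ultimately show ?thesis using n' Suc by simp
    qed
    have "\<exists>v \<in> A \<union> B. contractible_on E (A \<union> B - {v})"
    proof (cases m)
      case 0
      then show ?thesis using less.prems Suc by auto
    next
      case (Suc m')
      then obtain v where v: "v \<in> A" "contractible_on E (A - {v})" using less.prems(1) by auto
      have "contractible_on E ((A - {v}) \<union> B)"
        by (rule contractible_on_join) (use v fin less.prems in auto)
      moreover have "A \<union> B - {v} = (A - {v}) \<union> B" using v dis by blast
      ultimately show ?thesis using v(1) by (metis UnI1)
    qed
    then show ?thesis using nA nB by (auto simp: Suc)
  qed
qed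

text \<open>
  The common neighbourhood of a simplex \<open>z\<close> is an iterated unit sphere, and each vertex of \<open>z\<close>
  lowers the dimension by one.
\<close>

lemma sphere_on_link:
  assumes "finite z" "sphere_on E n L" "z \<subseteq> L" "pairwise E z"
  shows "card z \<le> n \<and> sphere_on E (n - card z) {w \<in> L. \<forall>u \<in> z. E u w}"
  using assms
proof (induction z arbitrary: n L rule: finite_induct)
  case empty
  then show ?case by simp
next
  case (insert u z)
  then obtain m where m: "n = Suc m" by (cases n) auto
  have "card z \<le> m \<and> sphere_on E (m - card z) {w \<in> nbrs E u L. \<forall>u \<in> z. E u w}"
    by (rule insert.IH) (use insert.prems insert.hyps m in \<open>auto simp: nbrs_def pairwise_def\<close>)
  moreover have "{w \<in> nbrs E u L. \<forall>u \<in> z. E u w} = {w \<in> L. \<forall>u \<in> insert u z. E u w}"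
    by (auto simp: nbrs_def)
  ultimately show ?case using m insert.hyps by simp
qed

end

section \<open>Subsets that attain all colours\<close>

abbreviation comparable :: "'a set \<Rightarrow> 'a set \<Rightarrow> bool" where
  "comparable x y \<equiv> x \<subset> y \<or> y \<subset> x"

interpretation incl: adjacency comparable
  by standard auto

text \<open>
  These are the proper non-empty faces of the product of the simplices spanned by the colour classes
  of \<open>x\<close>. For a constant \<open>g\<close> they are the boundary of the simplex \<open>x\<close>.
\<close>

definition faces_onto :: "('a \<Rightarrow> 'c) \<Rightarrow> 'a set \<Rightarrow> 'a set set" where
  "faces_onto g x = {y. y \<subset> x \<and> g ` y = g ` x}"

lemma finite_faces_onto: "finite x \<Longrightarrow> finite (faces_onto g x)"
  by (rule finite_subset[of _ "Pow x"]) (auto simp: faces_onto_def)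

text \<open>
  An open interval is again a family of this kind: when the elements of \<open>b\<close> get colours of their
  own and all others share one colour, a subset of \<open>x\<close> attains all colours if and only if it properly
  contains \<open>b\<close>. The elements of \<open>x\<close> themselves serve as colours here, so that the result can be
  used in an induction over colourings of a fixed type.
\<close>

lemma interval_eq_faces_onto:
  assumes "b \<subseteq> x" "t \<in> x - b"
  shows "{z. b \<subset> z \<and> z \<subset> x} = faces_onto (\<lambda>v. if v \<in> b then v else t) x"
proof -
  let ?h = "\<lambda>v. if v \<in> b then v else t"
  have hx: "?h ` x = insert t b" using assms by auto
  have "?h ` z = insert t b \<longleftrightarrow> b \<subset> z" for z
  proof -
    have "?h ` z = (z \<inter> b) \<union> (if z \<subseteq> b then {} else {t})" by auto
    then show ?thesis using assms(2) by (cases "z \<subseteq> b") auto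
  qed
  then show ?thesis unfolding faces_onto_def hx by (simp add: conj_commute)
qed

text \<open>
  As \<open>v\<close> and \<open>w\<close> have the same colour, either can be removed from a set that contains both, and
  \<open>v\<close> can always be inserted, without changing the colours. The sets with \<open>v\<close> but without \<open>w\<close> have a
  largest member, so they form a cone. The sets with both are then added from large to small, with
  apex \<open>y - {w}\<close>, and the sets without \<open>v\<close> from small to large, with apex \<open>insert v y\<close>.
  Only for \<open>x - {v}\<close> is this last apex missing, since inserting \<open>v\<close> gives \<open>x\<close>, which is not a
  proper subset.
\<close>

lemma contractible_on_faces_onto:
  assumes x: "finite x" and v: "v \<in> x" and w: "w \<in> x" "v \<noteq> w" "g v = g w"
  shows "contractible_on comparable (faces_onto g x - {x - {v}})"
proof -
  have del: "g ` (y - {w}) = g ` y" if "v \<in> y" for y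
  proof
    show "g ` y \<subseteq> g ` (y - {w})"
    proof
      fix c assume "c \<in> g ` y"
      then obtain u where u: "u \<in> y" "c = g u" by blast
      then show "c \<in> g ` (y - {w})"
        using that w by (cases "u = w") (auto intro: image_eqI[of _ g v])
    qed
  qed blast
  let ?A = "{y \<in> faces_onto g x. v \<in> y \<and> w \<notin> y}"
  let ?B = "{y \<in> faces_onto g x. v \<in> y \<and> w \<in> y}"
  let ?C = "{y \<in> faces_onto g x. v \<notin> y \<and> y \<noteq> x - {v}}"
  have fin: "finite S" if "S \<subseteq> faces_onto g x" for S
    using finite_faces_onto[OF x] that finite_subset by blast
  have finy: "finite y" if "y \<in> faces_onto g x" for y
    using that x finite_subset by (auto simp: faces_onto_def)
  have top: "x - {w} \<in> ?A"
    using v w del[OF v] by (auto simp: faces_onto_def)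
  have "contractible_on comparable (insert (x - {w}) (?A - {x - {w}}))"
  proof (rule incl.contractible_on_cone)
    show "finite (?A - {x - {w}})" by (rule fin) blast
    show "\<forall>b \<in> ?A - {x - {w}}. comparable (x - {w}) b"
      unfolding faces_onto_def by blast
  qed
  then have A: "contractible_on comparable ?A" using top by (simp add: insert_absorb)
  have AB: "contractible_on comparable (?A \<union> ?B)"
  proof (rule incl.contractible_on_add_cones[where h = card])
    show "\<forall>y \<in> ?B. \<exists>m \<in> ?A. comparable y m \<and> (\<forall>b \<in> ?A \<union> ?B. comparable y b \<and> b \<noteq> m \<and>
      (b \<in> ?B \<longrightarrow> card y \<le> card b) \<longrightarrow> comparable m b)"
    proof
      fix y assume y: "y \<in> ?B"
      show "\<exists>m \<in> ?A. comparable y m \<and> (\<forall>b \<in> ?A \<union> ?B. comparable y b \<and> b \<noteq> m \<and>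
        (b \<in> ?B \<longrightarrow> card y \<le> card b) \<longrightarrow> comparable m b)"
      proof (intro bexI[of _ "y - {w}"] conjI ballI impI)
        show "y - {w} \<in> ?A" using y w del[of y] by (auto simp: faces_onto_def)
        show "comparable y (y - {w})" using y by blast
        fix b assume b: "b \<in> ?A \<union> ?B"
          "comparable y b \<and> b \<noteq> y - {w} \<and> (b \<in> ?B \<longrightarrow> card y \<le> card b)"
        show "comparable (y - {w}) b"
        proof (cases "w \<in> b")
          case True
          then have "\<not> b \<subset> y" using b finy[of y] y psubset_card_mono[of y b] by auto
          then show ?thesis using b by blast
        next
          case False
          then show ?thesis using b y by blast
        qed
      qed
    qed
  qed (use fin A in auto)
  have "contractible_on comparable ((?A \<union> ?B) \<union> ?C)"
  proof (rule incl.contractible_on_add_cones[where h = "\<lambda>y. card (x - y)"])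
    show "\<forall>y \<in> ?C. \<exists>m \<in> ?A \<union> ?B. comparable y m \<and> (\<forall>b \<in> (?A \<union> ?B) \<union> ?C. comparable y b \<and> b \<noteq> m \<and>
      (b \<in> ?C \<longrightarrow> card (x - y) \<le> card (x - b)) \<longrightarrow> comparable m b)"
    proof
      fix y assume y: "y \<in> ?C"
      show "\<exists>m \<in> ?A \<union> ?B. comparable y m \<and> (\<forall>b \<in> (?A \<union> ?B) \<union> ?C. comparable y b \<and> b \<noteq> m \<and>
      (b \<in> ?C \<longrightarrow> card (x - y) \<le> card (x - b)) \<longrightarrow> comparable m b)"
      proof (intro bexI[of _ "insert v y"] conjI ballI impI)
        show "insert v y \<in> ?A \<union> ?B" using y v by (auto simp: faces_onto_def)
        show "comparable y (insert v y)" using y by blast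
        fix b assume b: "b \<in> (?A \<union> ?B) \<union> ?C"
          "comparable y b \<and> b \<noteq> insert v y \<and> (b \<in> ?C \<longrightarrow> card (x - y) \<le> card (x - b))"
        show "comparable (insert v y) b"
        proof (cases "v \<in> b")
          case True
          then show ?thesis using b y by blast
        next
          case False
          have "\<not> y \<subset> b"
          proof
            assume "y \<subset> b"
            then have "x - b \<subset> x - y" using b(1) by (auto simp: faces_onto_def)
            then have "card (x - b) < card (x - y)" using x by (intro psubset_card_mono) auto
            then show False using b False by auto
          qed
          then show ?thesis using b by blast
        qed
      qed
    qed
  qed (use fin AB in auto)
  moreover have "(?A \<union> ?B) \<union> ?C = faces_onto g x - {x - {v}}" by auto
  ultimately show ?thesis by simp
qed

text \<open>
  The unit sphere of \<open>y\<close> is the join of the family for \<open>y\<close> and the open interval from \<open>y\<close> to \<open>x\<close>.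
  Both are families of the same kind with a smaller excess of elements over colours, so induction on
  this excess handles them together. An excess of zero means that \<open>g\<close> is injective on \<open>x\<close> and the
  family is empty.
\<close>

lemma sphere_on_faces_onto_self:
  fixes g :: "'a \<Rightarrow> 'a"
  assumes "finite x"
  shows "sphere_on comparable (card x - card (g ` x)) (faces_onto g x)"
  using assms
proof (induction "card x - card (g ` x)" arbitrary: g x rule: less_induct)
  case less
  show ?case
  proof (cases "inj_on g x")
    case True
    then have "faces_onto g x = {}"
      by (auto simp: faces_onto_def inj_on_image_eq_iff[OF True])
    then show ?thesis using True by (simp add: card_image)
  next
    case False
    then have lt: "card (g ` x) < card x"
      using less.prems card_image_le eq_card_imp_inj_on by (metis le_neq_implies_less)
    then obtain p where p: "card x - card (g ` x) = Suc p"
      by (metis Suc_pred zero_less_diff)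
    obtain v w where vw: "v \<in> x" "w \<in> x" "v \<noteq> w" "g v = g w"
      using False by (auto simp: inj_on_def)
    have "x - {v} \<in> faces_onto g x"
      using vw by (auto simp: faces_onto_def image_iff)
    then have ex: "\<exists>y \<in> faces_onto g x. contractible_on comparable (faces_onto g x - {y})"
      using contractible_on_faces_onto[OF less.prems vw] by blast
    have "sphere_on comparable p (nbrs comparable y (faces_onto g x))"
      if y: "y \<in> faces_onto g x" for y
    proof -
      have y': "y \<subset> x" "g ` y = g ` x" using y by (auto simp: faces_onto_def)
      have fy: "finite y" using y'(1) less.prems finite_subset by blast
      have cy: "card y < card x" using y'(1) less.prems psubset_card_mono by blast
      have cgy: "card (g ` x) \<le> card y" using y'(2) fy card_image_le by metis
      obtain t where t: "t \<in> x - y" using y'(1) by blast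
      let ?h = "\<lambda>v. if v \<in> y then v else t"
      have hx: "?h ` x = insert t y" using t y'(1) by auto
      have ch: "card (?h ` x) = Suc (card y)" unfolding hx using fy t by simp
      have 1: "sphere_on comparable (card y - card (g ` y)) (faces_onto g y)"
        by (rule less.hyps) (use y' fy cy cgy in auto)
      have 2: "sphere_on comparable (card x - card (?h ` x)) (faces_onto ?h x)"
        by (rule less.hyps) (use ch cy cgy less.prems in linarith, use less.prems in simp)
      have "sphere_on comparable ((card y - card (g ` y)) + (card x - card (?h ` x)))
         (faces_onto g y \<union> faces_onto ?h x)"
        by (rule incl.sphere_on_join[OF 1 2],
            subst interval_eq_faces_onto[OF psubset_imp_subset[OF y'(1)] t, symmetric])
          (auto simp: faces_onto_def)
      moreover have "(card y - card (g ` y)) + (card x - card (?h ` x)) = p"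
        using p ch cy cgy y'(2) by simp
      moreover have "faces_onto g y \<union> faces_onto ?h x = nbrs comparable y (faces_onto g x)"
      proof (subst interval_eq_faces_onto[OF psubset_imp_subset[OF y'(1)] t, symmetric])
        show "faces_onto g y \<union> {z. y \<subset> z \<and> z \<subset> x} = nbrs comparable y (faces_onto g x)"
          (is "?l = ?r")
        proof
          show "?l \<subseteq> ?r"
          proof
            fix z assume "z \<in> ?l"
            then show "z \<in> ?r"
            proof
              assume "z \<in> faces_onto g y"
              then show ?thesis using y' by (auto simp: nbrs_def faces_onto_def)
            next
              assume z: "z \<in> {z. y \<subset> z \<and> z \<subset> x}"
              then have "g ` y \<subseteq> g ` z" "g ` z \<subseteq> g ` x" by blast+
              then have "g ` z = g ` x" using y'(2) by simp
              then show ?thesis using z by (simp add: nbrs_def faces_onto_def)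
            qed
          qed
          show "?r \<subseteq> ?l" using y' by (auto simp: nbrs_def faces_onto_def)
        qed
      qed
      ultimately show ?thesis by simp
    qed
    then show ?thesis using ex p by simp
  qed
qed

text \<open>
  Replacing each colour by a vertex of that colour reduces to colours of the type of the vertices.
\<close>

lemma sphere_on_faces_onto:
  assumes "finite x"
  shows "sphere_on comparable (card x - card (g ` x)) (faces_onto g x)"
proof -
  define r where "r = (\<lambda>c. SOME u. g u = c)"
  have gr: "g (r (g v)) = g v" for v
    unfolding r_def by (rule someI[of _ v]) simp
  then have g_image: "g ` (r \<circ> g) ` y = g ` y" for y
    by (simp add: image_image)
  have "(r \<circ> g) ` y = (r \<circ> g) ` x \<longleftrightarrow> g ` y = g ` x" for y
  proof
    assume "(r \<circ> g) ` y = (r \<circ> g) ` x"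
    then have "g ` (r \<circ> g) ` y = g ` (r \<circ> g) ` x" by (rule arg_cong)
    then show "g ` y = g ` x" unfolding g_image .
  qed (simp only: image_comp[symmetric])
  then have "faces_onto (r \<circ> g) x = faces_onto g x"
    by (simp only: faces_onto_def)
  moreover have "card ((r \<circ> g) ` x) = card (g ` x)"
  proof (rule bij_betw_same_card)
    show "bij_betw g ((r \<circ> g) ` x) (g ` x)"
      unfolding bij_betw_def g_image by (auto simp: inj_on_def gr)
  qed
  ultimately show ?thesis using sphere_on_faces_onto_self[OF assms, of "r \<circ> g"] by simp
qed

lemma sphere_on_interval:
  assumes "finite x" "b \<subset> x"
  shows "sphere_on comparable (card x - card b - 1) {z. b \<subset> z \<and> z \<subset> x}"
proof -
  obtain t where t: "t \<in> x - b" using assms by blast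
  have "(\<lambda>v. if v \<in> b then v else t) ` x = insert t b" using assms t by auto
  moreover have "card (insert t b) = Suc (card b)"
    using t assms finite_subset[of b x] by auto
  ultimately show ?thesis
    using interval_eq_faces_onto[OF psubset_imp_subset[OF assms(2)] t]
      sphere_on_faces_onto[OF assms(1), of "\<lambda>v. if v \<in> b then v else t"] by simp
qed

section \<open>Barycentric refinement of spheres\<close>

text \<open>
  If \<open>L\<close> is the common neighbourhood of a simplex \<open>x\<close>, these are the simplices properly containing
  \<open>x\<close>. For any \<open>L\<close> disjoint from \<open>x\<close> they form a copy of the barycentric refinement of the graph on
  \<open>L\<close>, with \<open>x\<close> added to every simplex. Carrying the set \<open>x\<close> along lets the unit spheres that occur in the proofs
  be of literally the same form.
\<close>

definition cofaces :: "('a \<Rightarrow> 'a \<Rightarrow> bool) \<Rightarrow> 'a set \<Rightarrow> 'a set \<Rightarrow> 'a set set" where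
  "cofaces E x L = {y. x \<subset> y \<and> y - x \<subseteq> L \<and> pairwise E (y - x)}"

context adjacency
begin

text \<open>
  The simplices through \<open>v\<close>, except the smallest one, are added to those that avoid \<open>v\<close> from large
  to small; the apex for \<open>y\<close> is its face \<open>y - {v}\<close>.
\<close>

lemma contractible_on_cofaces_del:
  assumes "finite x" "finite L" "x \<inter> L = {}" "v \<in> L"
    and A: "contractible_on comparable (cofaces E x (L - {v}))"
  shows "contractible_on comparable (cofaces E x L - {insert v x})"
proof -
  let ?A = "cofaces E x (L - {v})"
  let ?R = "{y \<in> cofaces E x L. v \<in> y \<and> y \<noteq> insert v x}"
  have v: "v \<notin> x" using assms by blast
  have finy: "finite y" if "y \<in> cofaces E x L" for y
    using that assms(1,2) finite_subset[of y "x \<union> L"] by (auto simp: cofaces_def)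
  have "contractible_on comparable (?A \<union> ?R)"
  proof (rule incl.contractible_on_add_cones[where h = card])
    show "finite ?R"
      by (rule finite_subset[of _ "Pow (x \<union> L)"]) (use assms(1,2) in \<open>auto simp: cofaces_def\<close>)
    show "?A \<inter> ?R = {}" using v by (auto simp: cofaces_def)
    show "\<forall>y \<in> ?R. \<exists>m \<in> ?A. comparable y m \<and> (\<forall>b \<in> ?A \<union> ?R. comparable y b \<and> b \<noteq> m \<and>
      (b \<in> ?R \<longrightarrow> card y \<le> card b) \<longrightarrow> comparable m b)"
    proof
      fix y assume y: "y \<in> ?R"
      show "\<exists>m \<in> ?A. comparable y m \<and> (\<forall>b \<in> ?A \<union> ?R. comparable y b \<and> b \<noteq> m \<and>
        (b \<in> ?R \<longrightarrow> card y \<le> card b) \<longrightarrow> comparable m b)"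
      proof (intro bexI[of _ "y - {v}"] conjI ballI impI)
        show "y - {v} \<in> ?A" using y v by (auto simp: cofaces_def pairwise_def)
        show "comparable y (y - {v})" using y by blast
        fix b assume b: "b \<in> ?A \<union> ?R"
          "comparable y b \<and> b \<noteq> y - {v} \<and> (b \<in> ?R \<longrightarrow> card y \<le> card b)"
        show "comparable (y - {v}) b"
        proof (cases "v \<in> b")
          case True
          then have "b \<in> ?R" using b v by (auto simp: cofaces_def)
          then have "\<not> b \<subset> y" using b(2) finy[of y] y psubset_card_mono[of y b] by auto
          then show ?thesis using b by blast
        next
          case False
          then show ?thesis using b y by blast
        qed
      qed
    qed
  qed (rule A)
  moreover have "?A \<union> ?R = cofaces E x L - {insert v x}"
    using v by (auto simp: cofaces_def)
  ultimately show ?thesis by simp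
qed

text \<open>
  When \<open>v\<close> is the vertex by which \<open>L\<close> is extended, the refinement of \<open>L - {v}\<close> is extended by the
  simplices through \<open>v\<close>. The last one to be added is \<open>insert v x\<close>, and its unit sphere is the
  refinement of the unit sphere of \<open>v\<close>.
\<close>

lemma contractible_on_cofaces:
  assumes "contractible_on E L" "finite x" "x \<inter> L = {}"
  shows "contractible_on comparable (cofaces E x L)"
  using assms
proof (induction arbitrary: x rule: contractible_on.induct)
  case (single v)
  then have "cofaces E x {v} = {insert v x}"
    by (auto simp: cofaces_def pairwise_def)
  then show ?case by (simp add: contractible_on.single)
next
  case (extend v L)
  have v: "v \<notin> x" using extend by blast
  have fL: "finite L" using contractible_on_finite[OF extend.hyps(3)] by simp
  have "insert v x \<in> cofaces E x L"
    using v extend.hyps(1) by (auto simp: cofaces_def pairwise_def)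
  moreover have "nbrs comparable (insert v x) (cofaces E x L)
      = cofaces E (insert v x) (nbrs E v L)" (is "?l = ?r")
  proof
    show "?l \<subseteq> ?r"
    proof
      fix y assume "y \<in> ?l"
      then have y: "y \<in> cofaces E x L" "insert v x \<subset> y"
        by (auto simp: nbrs_def cofaces_def)
      then show "y \<in> ?r" using v
        by (auto simp: nbrs_def cofaces_def pairwise_def)
    qed
    show "?r \<subseteq> ?l"
    proof
      fix y assume y: "y \<in> ?r"
      then have "y - x = insert v (y - insert v x)" using v by (auto simp: cofaces_def)
      moreover have "pairwise E (insert v (y - insert v x))"
        using y sym by (auto simp: pairwise_insert cofaces_def nbrs_def)
      ultimately show "y \<in> ?l" using y extend.hyps(1)
        by (auto simp: nbrs_def cofaces_def)
    qed
  qed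
  moreover have "contractible_on comparable (cofaces E (insert v x) (nbrs E v L))"
    by (rule extend.IH(1)) (use extend.prems irrefl in \<open>auto simp: nbrs_def\<close>)
  moreover have "contractible_on comparable (cofaces E x L - {insert v x})"
    by (rule contractible_on_cofaces_del) (use extend fL in auto)
  ultimately show ?case by - (rule contractible_on.extend[of "insert v x"], auto)
qed

text \<open>
  The unit sphere of \<open>y\<close> is the join of the interval from \<open>x\<close> to \<open>y\<close>, the boundary of a simplex,
  and of the refinement of the common neighbourhood of \<open>y - x\<close>, to which induction applies.
\<close>

lemma sphere_on_cofaces:
  assumes "sphere_on E n L" "finite x" "x \<inter> L = {}"
  shows "sphere_on comparable n (cofaces E x L)"
  using assms
proof (induction n arbitrary: x L rule: less_induct)
  case (less n)
  show ?case
  proof (cases n)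
    case 0
    then show ?thesis using less.prems by (auto simp: cofaces_def)
  next
    case (Suc p)
    have fL: "finite L" using sphere_on_finite[OF less.prems(1)] .
    obtain v where v: "v \<in> L" "contractible_on E (L - {v})" using less.prems(1) Suc by auto
    have "contractible_on comparable (cofaces E x L - {insert v x})"
      by (rule contractible_on_cofaces_del[OF less.prems(2) fL less.prems(3) v(1)], rule contractible_on_cofaces)
        (use v less.prems in auto)
    moreover have "insert v x \<in> cofaces E x L"
      using v less.prems(3) by (auto simp: cofaces_def pairwise_def)
    moreover have "sphere_on comparable p (nbrs comparable y (cofaces E x L))"
      if y: "y \<in> cofaces E x L" for y
    proof -
      let ?z = "y - x" and ?M = "{w \<in> L. \<forall>u \<in> y - x. E u w}"
      have z: "?z \<subseteq> L" "pairwise E ?z" "x \<subset> y" using y by (auto simp: cofaces_def)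
      have fz: "finite ?z" using z(1) fL finite_subset by blast
      have fy: "finite y" using fz less.prems(2) by simp
      have lk: "card ?z \<le> n" "sphere_on E (n - card ?z) ?M"
        using sphere_on_link[OF fz less.prems(1) z(1,2)] by auto
      have c: "card ?z = card y - card x"
        using z(3) less.prems(2) by (intro card_Diff_subset) auto
      have "card x < card y" using z(3) fy psubset_card_mono by blast
      then have c0: "0 < card ?z" using c by simp
      have M: "sphere_on comparable (n - card ?z) (cofaces E y ?M)"
        by (rule less.IH) (use lk c0 Suc fy less.prems irrefl in auto)
      have I: "sphere_on comparable (card ?z - 1) {w. x \<subset> w \<and> w \<subset> y}"
        using sphere_on_interval[OF fy z(3)] c by simp
      have "sphere_on comparable ((card ?z - 1) + (n - card ?z))
          ({w. x \<subset> w \<and> w \<subset> y} \<union> cofaces E y ?M)"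
        by (rule incl.sphere_on_join[OF I M]) (auto simp: cofaces_def)
      moreover have "(card ?z - 1) + (n - card ?z) = p" using c0 lk(1) Suc by simp
      moreover have "{w. x \<subset> w \<and> w \<subset> y} \<union> cofaces E y ?M = nbrs comparable y (cofaces E x L)"
        (is "?l = ?r")
      proof
        show "?r \<subseteq> ?l"
        proof
          fix w assume w: "w \<in> ?r"
          show "w \<in> ?l"
          proof (cases "w \<subset> y")
            case True
            then show ?thesis using w by (auto simp: nbrs_def cofaces_def)
          next
            case False
            then have "y \<subset> w" "w - x \<subseteq> L" "pairwise E (w - x)"
              using w by (auto simp: nbrs_def cofaces_def)
            moreover have "w - y \<subseteq> L" using \<open>w - x \<subseteq> L\<close> z(3) by blast
            moreover have "pairwise E (w - y)"
              by (rule pairwise_subset[OF \<open>pairwise E (w - x)\<close>]) (use z(3) in blast)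
            moreover have "E u v" if "u \<in> y - x" "v \<in> w - y" for u v
              by (rule pairwiseD[OF \<open>pairwise E (w - x)\<close>]) (use that z(3) \<open>y \<subset> w\<close> in blast)+
            ultimately show ?thesis by (auto simp: cofaces_def)
          qed
        qed
        have "w \<in> ?r" if w: "x \<subset> w" "w \<subset> y" for w
          using w z by (auto simp: nbrs_def cofaces_def intro: pairwise_subset)
        moreover have "w \<in> ?r" if w: "w \<in> cofaces E y ?M" for w
        proof -
          have "w - x = (y - x) \<union> (w - y)" using w z(3) by (auto simp: cofaces_def)
          moreover have "pairwise E ((y - x) \<union> (w - y))"
            using w z(2) sym by (auto simp: cofaces_def pairwise_def)
          ultimately show ?thesis using w z by (auto simp: nbrs_def cofaces_def)
        qed
        ultimately show "?l \<subseteq> ?r" by blast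
      qed
      ultimately show ?thesis by simp
    qed
    ultimately show ?thesis using Suc by auto
  qed
qed

end

section \<open>Level surfaces\<close>

theorem theorem4:
  fixes d :: nat and G :: "('a, 'b) pre_digraph" and f :: "'a \<Rightarrow> real ^ 'k"
    and W :: "(real ^ 'k) set" and c :: "real ^ 'k"
  assumes "graph G" and "is_manifold (int d) G"
    and "W \<subseteq> {w. \<forall>i. w $ i \<in> {-1, 1}}" and "card W = CARD('k)"
    and "c \<notin> f ` verts G"
  shows "is_manifold (int d - int CARD('k)) (level_surface W G f c)
    \<or> verts (level_surface W G f c) = {}"
proof (rule disjI1)
  interpret G: graph G by fact
  let ?E = "\<lambda>u v. u \<rightarrow>\<^bsub>G\<^esub> v" and ?k = "CARD('k)"
  interpret adj: adjacency ?E
    by standard (use arcs_ends_symmetric[OF G.sym_arcs] G.adj_not_same in auto)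
  let ?S = "level_surface W G f c"
  define s where "s = (\<lambda>v. sign_vec (f v - c))"
  define col where "col = (\<lambda>v. if s v \<in> W then Some (s v) else None)"
  have "finite W" using assms(4) by (metis card_ge_0_finite zero_less_card_finite)
  let ?C = "insert None (Some ` W)"
  have card_C: "card ?C = ?k + 1"
    using \<open>finite W\<close> assms(4) by (simp add: card_image)
  have finite_simplex: "finite x" if "x \<in> simplices G" for x
    using that finite_subset[OF _ G.finite_verts] by (auto simp: simplices_def)
  have all_colours: "?k + 1 \<le> card (s ` x) \<and> W \<subseteq> s ` x \<longleftrightarrow> col ` x = ?C" if "finite x" for x
  proof
    assume *: "?k + 1 \<le> card (s ` x) \<and> W \<subseteq> s ` x"
    then have "s ` x \<noteq> W" using assms(4) by auto
    then obtain v where v: "v \<in> x" "s v \<notin> W" using * by blast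
    have "Some w \<in> col ` x" if w: "w \<in> W" for w
    proof -
      obtain u where "u \<in> x" "w = s u" using w * by blast
      then have "u \<in> x" "col u = Some w" using w by (auto simp: col_def)
      then show ?thesis by (metis image_eqI)
    qed
    moreover have "None \<in> col ` x" using v by (auto simp: col_def image_iff)
    ultimately show "col ` x = ?C" by (auto simp: col_def)
  next
    assume *: "col ` x = ?C"
    have sub: "W \<subseteq> s ` x"
    proof
      fix w assume "w \<in> W"
      then have "Some w \<in> col ` x" using * by simp
      then show "w \<in> s ` x" by (auto simp: col_def split: if_splits)
    qed
    have "None \<in> col ` x" using * by simp
    then obtain v where v: "v \<in> x" "None = col v" by (rule imageE)
    then have "s v \<notin> W" by (cases "s v \<in> W") (simp_all add: col_def)
    then have "W \<subset> s ` x" using sub v(1) by blast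
    then have "card W < card (s ` x)"
      by (rule psubset_card_mono[rotated]) (use that in simp)
    then show "?k + 1 \<le> card (s ` x) \<and> W \<subseteq> s ` x" using sub assms(4) by simp
  qed
  have "verts ?S = {x \<in> simplices G. ?k + 1 \<le> card (s ` x) \<and> W \<subseteq> s ` x}"
    unfolding level_surface_def s_def by (simp only: induce_subgraph_verts)
  then have verts_S: "verts ?S = {x \<in> simplices G. col ` x = ?C}"
    using all_colours[OF finite_simplex] by (simp cong: conj_cong)
  have adj_S: "has_adjacency ?S comparable"
    by (auto simp: has_adjacency_def level_surface_def dominates_induce_subgraph
        barycentric_refinement_def arcs_ends_def arc_to_ends_def)
  have adj_G: "has_adjacency G ?E" by (simp add: has_adjacency_def)
  show "is_manifold (int d - int ?k) ?S"
  proof (rule is_manifold_is_sphere.manifold, rule ballI)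
    fix x assume xS: "x \<in> verts ?S"
    then have x: "x \<noteq> {}" "x \<subseteq> verts G" "pairwise ?E x" "finite x" "col ` x = ?C"
      using finite_simplex by (auto simp: verts_S simplices_def pairwise_def)
    obtain v where v: "v \<in> x" using x(1) by blast
    \<comment> \<open>The manifold condition speaks of single vertices, so the common neighbourhood \<open>?L\<close> of \<open>x\<close>
      is taken as the link of \<open>x - {v}\<close> in the sphere around one chosen vertex \<open>v\<close> of \<open>x\<close>.\<close>
    let ?L = "{w \<in> nbrs ?E v (verts G). \<forall>u \<in> x - {v}. ?E u w}"
    have "is_sphere (int d - 1) (unit_sphere G v)"
      using assms(2) v x(2) by (auto simp: is_manifold.simps)
    then have "sphere_on ?E d (nbrs ?E v (verts G))"
      using is_sphere_iff_sphere_on[OF has_adjacency_unit_sphere[OF adj_G], where n = d]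
        verts_unit_sphere[OF adj_G] v x(2) by auto
    then have link: "card (x - {v}) \<le> d \<and> sphere_on ?E (d - card (x - {v})) ?L"
      by (intro adj.sphere_on_link) (use v x in \<open>auto simp: nbrs_def pairwise_def\<close>)
    have card_link: "card (x - {v}) = card x - 1" "card x - 1 \<le> d"
      using link v x(4) by simp_all
    have L: "?L = {w \<in> verts G. \<forall>u \<in> x. ?E u w}"
      using v by (auto simp: nbrs_def)
    have card_x: "?k + 1 \<le> card x"
      using card_image_le[OF x(4), of col] card_C x(5) by simp
    have up: "sphere_on comparable (d - card (x - {v})) (cofaces ?E x ?L)"
      by (rule adj.sphere_on_cofaces) (use link x(4) L adj.irrefl in auto)
    have down: "sphere_on comparable (card x - (?k + 1)) (faces_onto col x)"
      using sphere_on_faces_onto[OF x(4), of col] x(5) card_C by simp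
    have "sphere_on comparable ((card x - (?k + 1)) + (d - card (x - {v})))
        (faces_onto col x \<union> cofaces ?E x ?L)"
      by (rule incl.sphere_on_join[OF down up]) (auto simp: faces_onto_def cofaces_def)
    moreover have "(card x - (?k + 1)) + (d - card (x - {v})) = d - ?k"
      using card_x card_link by linarith
    moreover have "faces_onto col x \<union> cofaces ?E x ?L = nbrs comparable x (verts ?S)"
      (is "?l = ?r")
    proof
      have "y \<in> ?r" if y: "y \<in> faces_onto col x" for y
      proof -
        have "y \<noteq> {}" using y x(5) by (auto simp: faces_onto_def)
        moreover have "y \<subset> x" "col ` y = ?C" using y x(5) by (auto simp: faces_onto_def)
        moreover from this have "pairwise ?E y" using x(3) pairwise_subset by blast
        ultimately show ?thesis using x(2)
          by (auto simp: nbrs_def verts_S simplices_def pairwise_def)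
      qed
      moreover have "y \<in> ?r" if y: "y \<in> cofaces ?E x ?L" for y
      proof -
        have y': "x \<subset> y" "y - x \<subseteq> ?L" "pairwise ?E (y - x)"
          using y by (auto simp: cofaces_def)
        have "pairwise ?E y"
          using y' x(3) unfolding L pairwise_def by (smt (verit) DiffI adj.sym mem_Collect_eq subsetD)
        moreover have "y \<subseteq> verts G" using y' x(2) unfolding L by blast
        moreover have "col ` y = ?C"
        proof
          show "?C \<subseteq> col ` y" using y'(1) x(5) by blast
        qed (auto simp: col_def)
        ultimately show ?thesis using y'(1) x(1)
          by (auto simp: nbrs_def verts_S simplices_def pairwise_def)
      qed
      ultimately show "?l \<subseteq> ?r" by blast
      show "?r \<subseteq> ?l"
      proof
        fix y assume "y \<in> ?r"
        then have y: "comparable x y" "y \<subseteq> verts G" "pairwise ?E y" "col ` y = ?C"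
          by (auto simp: nbrs_def verts_S simplices_def pairwise_def)
        show "y \<in> ?l"
        proof (cases "y \<subset> x")
          case True
          then show ?thesis using y x(5) by (simp add: faces_onto_def)
        next
          case False
          then have xy: "x \<subset> y" using y by blast
          have "u \<rightarrow>\<^bsub>G\<^esub> w" if "u \<in> x" "w \<in> y - x" for u w
            by (rule pairwiseD[OF y(3)]) (use that xy in blast)+
          then have "y - x \<subseteq> ?L" unfolding L using y(2) by blast
          moreover have "pairwise ?E (y - x)" using y(3) by (rule pairwise_subset) blast
          ultimately show ?thesis using xy by (simp add: cofaces_def)
        qed
      qed
    qed
    ultimately have "sphere_on comparable (d - ?k) (verts (unit_sphere ?S x))"
      using verts_unit_sphere[OF adj_S xS] by simp
    then have "is_sphere (int (d - ?k) - 1) (unit_sphere ?S x)"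
      using is_sphere_iff_sphere_on[OF has_adjacency_unit_sphere[OF adj_S]] by blast
    moreover have "?k \<le> d" using card_x card_link by linarith
    ultimately show "is_sphere (int d - int ?k - 1) (unit_sphere ?S x)"
      by (simp add: of_nat_diff)
  qed
qed

end
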